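(* Let $\Gamma$ be a group acting properly discontinuously and isometrically on a proper, geodesically complete, geodesic metric space $X$. Then the geodesic flow $\phi=(g^t)_{t\in\mathbb{R}}$ on $SX$ satisfies $h_{\mathrm{top}}(\phi)\ge\delta_\Gamma$.
   Context: Proper means all closed balls are compact. A geodesic in $X$ is an isometric embedding $v\colon\mathbb{R}\to X$; a geodesic segment is an isometric embedding of a compact interval. $X$ is geodesic if every pair of distinct points are the endpoints of a geodesic segment, and geodesically complete if every geodesic segment extends to a geodesic $\mathbb{R}\to X$. $SX$ is the set of all geodesics $\mathbb{R}\to X$ with metric $d_{SX}(v,w)=\sup_{t\in\mathbb{R}}e^{-|t|}d_X(v(t),w(t))$; the geodesic flow is $(g^tv)(r)=v(t+r)$. The critical exponent is $\delta_\Gamma=\inf\{s\ge0:\sum_{\gamma\in\Gamma}e^{-s\,d(p,\gamma q)}<\infty\}$, independent of $p,q\in X$. Topological entropy: for a continuous self-map $f$ of a metric space $Z$ and $Y\subseteq Z$, a subset $A\subseteq Y$ $(n,\varepsilon)$-spans $Y$ if for all $y\in Y$ there is $a\in A$ with $d(f^i(y),f^i(a))\le\varepsilon$ for all $0\le i<n$; $r_n(f,Y,\varepsilon)$ is the minimal cardinality of an $(n,\varepsilon)$-spanning set; $h_{\mathrm{top}}(f,Y)=\lim_{\varepsilon\to0^+}\limsup_{n\to\infty}\frac1n\log r_n(f,Y,\varepsilon)$ and $h_{\mathrm{top}}(f)=\sup\{h_{\mathrm{top}}(f,K):K\subseteq Z\text{ compact}\}$. The topological entropy of a flow is that of its time-one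 map: $h_{\mathrm{top}}(\phi)=h_{\mathrm{top}}(g^1)$. *)

theory Defs
  imports "HOL-Analysis.Analysis" "HOL-Algebra.Group_Action"
begin

definition isometric_embedding_on :: "'a::metric_space set \<Rightarrow> ('a \<Rightarrow> 'b::metric_space) \<Rightarrow> bool"
  where "isometric_embedding_on S f \<longleftrightarrow> (\<forall>x\<in>S. \<forall>y\<in>S. dist (f x) (f y) = dist x y)"

definition geodesic :: "(real \<Rightarrow> 'a::metric_space) \<Rightarrow> bool"
  where "geodesic v \<longleftrightarrow> isometric_embedding_on UNIV v"

text \<open>A geodesic segment is given by its domain \<open>[a, b]\<close> together with a total function of which
  only the values on \<open>[a, b]\<close> matter.  One-point intervals are allowed.\<close>

definition geodesic_segment :: "real \<Rightarrow> real \<Rightarrow> (real \<Rightarrow> 'a::metric_space) \<Rightarrow> bool"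
  where "geodesic_segment a b c \<longleftrightarrow> a \<le> b \<and> isometric_embedding_on {a..b} c"

definition proper_metric_space :: "'a::metric_space itself \<Rightarrow> bool"
  where "proper_metric_space _ \<longleftrightarrow> (\<forall>(x::'a) r. compact (cball x r))"

definition geodesic_metric_space :: "'a::metric_space itself \<Rightarrow> bool"
  where "geodesic_metric_space _ \<longleftrightarrow>
    (\<forall>x y::'a. x \<noteq> y \<longrightarrow> (\<exists>a b c. geodesic_segment a b c \<and> c a = x \<and> c b = y))"

definition geodesically_complete :: "'a::metric_space itself \<Rightarrow> bool"
  where "geodesically_complete _ \<longleftrightarrow>
    (\<forall>a b (c::real \<Rightarrow> 'a). geodesic_segment a b c \<longrightarrow>
      (\<exists>v. geodesic v \<and> (\<forall>t\<in>{a..b}. v t = c t)))"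

definition geodesics :: "(real \<Rightarrow> 'a::metric_space) set"
  where "geodesics = {v. geodesic v}"

text \<open>The value \<open>0\<close> off the space of geodesics is junk: the locale \<open>Metric_space\<close> asks for
  nonnegativity and symmetry of the distance on the whole type.\<close>

definition geodesics_dist :: "(real \<Rightarrow> 'a::metric_space) \<Rightarrow> (real \<Rightarrow> 'a) \<Rightarrow> real"
  where "geodesics_dist v w =
    (if v \<in> geodesics \<and> w \<in> geodesics then SUP t. exp (- \<bar>t\<bar>) * dist (v t) (w t) else 0)"

definition geodesic_flow :: "real \<Rightarrow> (real \<Rightarrow> 'a) \<Rightarrow> (real \<Rightarrow> 'a)"
  where "geodesic_flow t v = (\<lambda>r. v (t + r))"

definition isometric_action :: "('g, 'm) monoid_scheme \<Rightarrow> ('g \<Rightarrow> 'a::metric_space \<Rightarrow> 'a) \<Rightarrow> bool"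
  where "isometric_action G act \<longleftrightarrow> (\<forall>g\<in>carrier G. isometric_embedding_on UNIV (act g))"

definition properly_discontinuous_action ::
    "('g, 'm) monoid_scheme \<Rightarrow> ('g \<Rightarrow> 'a::topological_space \<Rightarrow> 'a) \<Rightarrow> bool"
  where "properly_discontinuous_action G act \<longleftrightarrow>
    (\<forall>K. compact K \<longrightarrow> finite {g \<in> carrier G. act g ` K \<inter> K \<noteq> {}})"

text \<open>Extended-real valued, so that the infimum of the empty set is \<open>\<infinity>\<close>.\<close>

definition critical_exponent ::
    "('g, 'm) monoid_scheme \<Rightarrow> ('g \<Rightarrow> 'a::metric_space \<Rightarrow> 'a) \<Rightarrow> 'a \<Rightarrow> 'a \<Rightarrow> ereal"
  where "critical_exponent G act p q =
    Inf (ereal ` {s. 0 \<le> s \<and> (\<lambda>g. exp (- s * dist p (act g q))) summable_on carrier G})"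

definition spans ::
    "('z \<Rightarrow> 'z \<Rightarrow> real) \<Rightarrow> ('z \<Rightarrow> 'z) \<Rightarrow> 'z set \<Rightarrow> nat \<Rightarrow> real \<Rightarrow> 'z set \<Rightarrow> bool"
  where "spans d f Y n \<epsilon> A \<longleftrightarrow>
    A \<subseteq> Y \<and> (\<forall>y\<in>Y. \<exists>a\<in>A. \<forall>i<n. d ((f ^^ i) y) ((f ^^ i) a) \<le> \<epsilon>)"

definition ext_card :: "'z set \<Rightarrow> enat"
  where "ext_card A = (if finite A then enat (card A) else \<infinity>)"

definition span_number ::
    "('z \<Rightarrow> 'z \<Rightarrow> real) \<Rightarrow> ('z \<Rightarrow> 'z) \<Rightarrow> 'z set \<Rightarrow> nat \<Rightarrow> real \<Rightarrow> enat"
  where "span_number d f Y n \<epsilon> = (INF A\<in>{A. spans d f Y n \<epsilon> A}. ext_card A)"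

fun log_enat :: "enat \<Rightarrow> ereal"
  where "log_enat (enat m) = (if m = 0 then -\<infinity> else ereal (ln (real m)))"
  | "log_enat \<infinity> = \<infinity>"

definition span_growth ::
    "('z \<Rightarrow> 'z \<Rightarrow> real) \<Rightarrow> ('z \<Rightarrow> 'z) \<Rightarrow> 'z set \<Rightarrow> real \<Rightarrow> ereal"
  where "span_growth d f Y \<epsilon> =
    limsup (\<lambda>n. ereal (1 / real n) * log_enat (span_number d f Y n \<epsilon>))"

definition top_entropy_on :: "('z \<Rightarrow> 'z \<Rightarrow> real) \<Rightarrow> ('z \<Rightarrow> 'z) \<Rightarrow> 'z set \<Rightarrow> ereal"
  where "top_entropy_on d f Y = Lim (at_right 0) (span_growth d f Y)"

definition top_entropy :: "'z set \<Rightarrow> ('z \<Rightarrow> 'z \<Rightarrow> real) \<Rightarrow> ('z \<Rightarrow> 'z) \<Rightarrow> ereal"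
  where "top_entropy Z d f =
    (SUP K\<in>{K. compactin (Metric_space.mtopology Z d) K}. top_entropy_on d f K)"

definition flow_entropy :: "'z set \<Rightarrow> ('z \<Rightarrow> 'z \<Rightarrow> real) \<Rightarrow> (real \<Rightarrow> 'z \<Rightarrow> 'z) \<Rightarrow> ereal"
  where "flow_entropy Z d \<phi> = top_entropy Z d (\<phi> 1)"

lemma geodesicsD: "v \<in> geodesics \<Longrightarrow> dist (v s) (v t) = \<bar>s - t\<bar>"
  by (simp add: geodesics_def geodesic_def isometric_embedding_on_def dist_real_def)

lemma geodesics_dist_bound:
  assumes "v \<in> geodesics" "w \<in> geodesics"
  shows "exp (- \<bar>t\<bar>) * dist (v t) (w t) \<le> dist (v 0) (w 0) + 2"
proof -
  have "dist (v t) (w t) \<le> dist (v t) (v 0) + dist (v 0) (w 0) + dist (w 0) (w t)"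
    by (metis add.commute add_left_mono dist_triangle dist_triangle_le dist_commute)
  also have "\<dots> = dist (v 0) (w 0) + 2 * \<bar>t\<bar>"
    by (simp add: geodesicsD assms)
  finally have "exp (- \<bar>t\<bar>) * dist (v t) (w t)
      \<le> exp (- \<bar>t\<bar>) * dist (v 0) (w 0) + 2 * (exp (- \<bar>t\<bar>) * \<bar>t\<bar>)"
    by (metis (no_types, opaque_lifting) distrib_left exp_ge_zero mult.left_commute mult_left_mono)
  moreover have "exp (- \<bar>t\<bar>) * dist (v 0) (w 0) \<le> dist (v 0) (w 0)"
    by (simp add: mult_left_le_one_le)
  moreover have "exp (- \<bar>t\<bar>) * \<bar>t\<bar> \<le> 1"
  proof -
    have "\<bar>t\<bar> \<le> exp \<bar>t\<bar>"
      using exp_ge_add_one_self[of "\<bar>t\<bar>"] by linarith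
    then show ?thesis by (simp add: exp_minus field_simps)
  qed
  ultimately show ?thesis by linarith
qed

lemma geodesics_dist_bdd:
  assumes "v \<in> geodesics" "w \<in> geodesics"
  shows "bdd_above (range (\<lambda>t. exp (- \<bar>t\<bar>) * dist (v t) (w t)))"
  using geodesics_dist_bound[OF assms] by (auto intro!: bdd_aboveI)

lemma geodesics_dist_upper:
  assumes "v \<in> geodesics" "w \<in> geodesics"
  shows "exp (- \<bar>t\<bar>) * dist (v t) (w t) \<le> geodesics_dist v w"
  using assms by (auto simp: geodesics_dist_def intro!: cSUP_upper geodesics_dist_bdd)

lemma geodesics_dist_least:
  assumes "v \<in> geodesics" "w \<in> geodesics"
    and "\<And>t. exp (- \<bar>t\<bar>) * dist (v t) (w t) \<le> B"
  shows "geodesics_dist v w \<le> B"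
  using assms by (auto simp: geodesics_dist_def intro!: cSUP_least)

lemma Metric_space_geodesics: "Metric_space geodesics geodesics_dist"
proof
  fix v w u :: "real \<Rightarrow> 'a"
  show "0 \<le> geodesics_dist v w"
  proof (cases "v \<in> geodesics \<and> w \<in> geodesics")
    case True
    then show ?thesis
      using geodesics_dist_upper[of v w 0] order_trans[OF zero_le_dist[of "v 0" "w 0"]] by simp
  qed (auto simp: geodesics_dist_def)
  show "geodesics_dist v w = geodesics_dist w v"
    by (simp add: geodesics_dist_def dist_commute conj_commute)
  assume v: "v \<in> geodesics" and w: "w \<in> geodesics"
  show "geodesics_dist v w = 0 \<longleftrightarrow> v = w"
  proof
    assume 0: "geodesics_dist v w = 0"
    show "v = w"
    proof
      fix t
      have "exp (- \<bar>t\<bar>) * dist (v t) (w t) \<le> 0"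
        using geodesics_dist_upper[OF v w, of t] 0 by simp
      then show "v t = w t"
        by (simp add: mult_le_0_iff)
    qed
  qed (simp add: geodesics_dist_def)
  assume u: "u \<in> geodesics"
  show "geodesics_dist v u \<le> geodesics_dist v w + geodesics_dist w u"
  proof (rule geodesics_dist_least[OF v u])
    fix t
    have "exp (- \<bar>t\<bar>) * dist (v t) (u t)
        \<le> exp (- \<bar>t\<bar>) * dist (v t) (w t) + exp (- \<bar>t\<bar>) * dist (w t) (u t)"
      by (metis distrib_left dist_triangle exp_ge_zero mult_left_mono)
    then show "exp (- \<bar>t\<bar>) * dist (v t) (u t) \<le> geodesics_dist v w + geodesics_dist w u"
      using geodesics_dist_upper[OF v w, of t] geodesics_dist_upper[OF w u, of t] by linarith
  qed
qed

lemma geodesic_flow_in_geodesics: "v \<in> geodesics \<Longrightarrow> geodesic_flow t v \<in> geodesics"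
  by (simp add: geodesics_def geodesic_def isometric_embedding_on_def geodesic_flow_def)

lemma geodesics_dist_flow:
  assumes v: "v \<in> geodesics" and w: "w \<in> geodesics"
  shows "geodesics_dist (geodesic_flow s v) (geodesic_flow s w) \<le> exp \<bar>s\<bar> * geodesics_dist v w"
proof (rule geodesics_dist_least)
  fix t
  let ?D = "dist (v (s + t)) (w (s + t))"
  have "exp (- \<bar>t\<bar>) \<le> exp \<bar>s\<bar> * exp (- \<bar>s + t\<bar>)"
    by (simp flip: exp_add)
  then have "exp (- \<bar>t\<bar>) * ?D \<le> exp \<bar>s\<bar> * (exp (- \<bar>s + t\<bar>) * ?D)"
    by (metis mult.assoc mult_right_mono zero_le_dist)
  also have "\<dots> \<le> exp \<bar>s\<bar> * geodesics_dist v w"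
    using geodesics_dist_upper[OF v w] by simp
  finally show "exp (- \<bar>t\<bar>) * dist (geodesic_flow s v t) (geodesic_flow s w t)
      \<le> exp \<bar>s\<bar> * geodesics_dist v w"
    by (simp add: geodesic_flow_def)
qed (use assms geodesic_flow_in_geodesics in auto)

lemma continuous_map_geodesic_flow:
  "continuous_map (Metric_space.mtopology geodesics geodesics_dist)
     (Metric_space.mtopology geodesics geodesics_dist) (geodesic_flow s)"
  unfolding Metric_space.metric_continuous_map[OF Metric_space_geodesics Metric_space_geodesics]
proof (intro conjI ballI allI impI)
  show "geodesic_flow s ` geodesics \<subseteq> geodesics"
    using geodesic_flow_in_geodesics by blast
  fix v :: "real \<Rightarrow> 'a" and \<epsilon> :: real
  assume v: "v \<in> geodesics" and \<epsilon>: "\<epsilon> > 0"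
  have "geodesics_dist (geodesic_flow s v) (geodesic_flow s w) < \<epsilon>"
    if w: "w \<in> geodesics" and lt: "geodesics_dist v w < \<epsilon> / exp \<bar>s\<bar>" for w
    using geodesics_dist_flow[OF v w, of s] lt by (simp add: field_simps)
  then show "\<exists>\<delta>>0. \<forall>w. w \<in> geodesics \<and> geodesics_dist v w < \<delta> \<longrightarrow>
      geodesics_dist (geodesic_flow s v) (geodesic_flow s w) < \<epsilon>"
    using \<epsilon> by (intro exI[of _ "\<epsilon> / exp \<bar>s\<bar>"]) auto
qed

lemma log_enat_mono: "m \<le> n \<Longrightarrow> log_enat m \<le> log_enat n"
  by (cases m; cases n) auto

lemma span_growth_antimono:
  assumes "\<epsilon> \<le> \<epsilon>'"
  shows "span_growth d f Y \<epsilon>' \<le> span_growth d f Y \<epsilon>"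
proof -
  have "span_number d f Y n \<epsilon>' \<le> span_number d f Y n \<epsilon>" for n
    unfolding span_number_def
    by (rule INF_superset_mono) (use assms in \<open>auto simp: spans_def intro: order_trans\<close>,
      meson assms order_trans)
  then show ?thesis
    unfolding span_growth_def
    by (intro Limsup_mono always_eventually allI ereal_mult_left_mono log_enat_mono) auto
qed

lemma span_growth_tendsto:
  "(span_growth d f Y \<longlongrightarrow> (SUP \<epsilon>\<in>{0<..}. span_growth d f Y \<epsilon>)) (at_right 0)"
proof (rule order_tendstoI)
  fix a assume "a < (SUP \<epsilon>\<in>{0<..}. span_growth d f Y \<epsilon>)"
  then obtain e where e: "e > 0" "a < span_growth d f Y e"
    by (auto simp: less_SUP_iff)
  have "\<forall>\<^sub>F x in at_right 0. x < e"
    using e(1) eventually_at_right_field by blast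
  then show "\<forall>\<^sub>F x in at_right 0. a < span_growth d f Y x"
    by eventually_elim (use e span_growth_antimono in \<open>meson less_imp_le less_le_trans\<close>)
next
  fix a assume a: "(SUP \<epsilon>\<in>{0<..}. span_growth d f Y \<epsilon>) < a"
  show "\<forall>\<^sub>F x in at_right 0. span_growth d f Y x < a"
    using eventually_at_right_less[of "0::real"]
    by eventually_elim (metis a SUP_upper greaterThan_iff le_less_trans)
qed

lemma top_entropy_on_eq_SUP:
  "top_entropy_on d f Y = (SUP \<epsilon>\<in>{0<..}. span_growth d f Y \<epsilon>)"
  unfolding top_entropy_on_def by (intro tendsto_Lim span_growth_tendsto) simp

end

theory Submission
  imports Defs
begin

text \<open>Let \<open>K\<close> be the compact set of geodesics issuing from \<open>p\<close>. Every orbit point \<open>\<gamma>q\<close> with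
  \<open>n \<le> d(p, \<gamma>q) < n + 1\<close> lies on some \<open>v \<in> K\<close>, at distance less than \<open>1\<close> from \<open>v(n)\<close>. A geodesic
  that shadows \<open>v\<close> up to time \<open>n\<close> therefore passes near \<open>\<gamma>q\<close> at time \<open>n\<close>, and only a bounded
  number of orbit points lie near a given point. So the number of orbit points at distance about
  \<open>n\<close> is at most a constant times the \<open>(n + 1, 1)\<close>-spanning number of \<open>K\<close>, and the Poincare series
  converges at every exponent above the entropy.\<close>

section \<open>Compactness of the set of geodesics issuing from a point\<close>

text \<open>Two geodesics issuing from \<open>p\<close> are at most 2t apart at times t and -t, so
  this controls the tails of the supremum in \<open>geodesics_dist\<close>. The bound t^2/2 \<le>
  exp t beats the linear factor once t > 4/\<epsilon>.\<close>

lemma exp_neg_times_eventually_small: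
  fixes \<epsilon> :: real
  assumes "\<epsilon> > 0"
  obtains T where "T > 0" and "\<And>t. t \<ge> T \<Longrightarrow> exp (- t) * (2 * t) < \<epsilon>"
proof
  show "4 / \<epsilon> + 1 > 0"
    using assms by (simp add: add_pos_pos)
  fix t assume t: "t \<ge> 4 / \<epsilon> + 1"
  then have "t > 4 / \<epsilon>" by simp
  moreover have "4 / \<epsilon> > 0" using assms by simp
  ultimately have "t > 0" by linarith
  have "4 < \<epsilon> * t"
    using \<open>t > 4 / \<epsilon>\<close> assms by (simp add: field_simps)
  then have "4 * t < \<epsilon> * t * t"
    using \<open>t > 0\<close> by simp
  moreover have "t\<^sup>2 / 2 \<le> exp t"
    using exp_lower_Taylor_quadratic[of t] \<open>t > 0\<close> by simp
  then have "\<epsilon> * (t\<^sup>2 / 2) \<le> \<epsilon> * exp t"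
    using assms by simp
  ultimately have "2 * t < \<epsilon> * exp t"
    by (simp add: power2_eq_square)
  then show "exp (- t) * (2 * t) < \<epsilon>"
    by (simp add: exp_minus field_simps)
qed

text \<open>Such a geodesic sends t into the compact ball of radius |t| about \<open>p\<close>, and
  the product of these balls is compact by Tychonoff. Being isometric is a family of closed
  conditions on pairs of coordinates.\<close>

lemma compact_geodesics_from_pointwise:
  fixes p :: "'a::metric_space"
  assumes "proper_metric_space TYPE('a)"
  shows "compact {v \<in> geodesics. v 0 = p}"
proof -
  let ?B = "PiE UNIV (\<lambda>t::real. cball p \<bar>t\<bar>)"
  have "compactin (product_topology (\<lambda>t::real. euclidean :: 'a topology) UNIV) ?B"
    using assms by (auto simp: compactin_PiE proper_metric_space_def)
  then have "compact ?B"
    by (simp add: euclidean_product_topology)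
  moreover have "closed {v :: real \<Rightarrow> 'a. v \<in> geodesics \<and> v 0 = p}"
    unfolding geodesics_def geodesic_def isometric_embedding_on_def
    by (auto intro!: closed_Collect_conj closed_Collect_all closed_Collect_eq
        continuous_on_dist continuous_on_product_coordinates)
  moreover have "{v \<in> geodesics. v 0 = p} \<subseteq> ?B"
    using geodesicsD by fastforce
  ultimately show ?thesis
    by (metis (no_types, lifting) compact_Int_closed inf.absorb_iff2)
qed

text \<open>By Tychonoff's theorem it suffices that the topology of \<open>d\<^sub>S\<^sub>X\<close> agrees on this set with the
  pointwise topology, which holds since geodesics are 1-Lipschitz and diverge at most linearly.\<close>

lemma compactin_geodesics_from:
  fixes p :: "'a::metric_space"
  assumes "proper_metric_space TYPE('a)"
  shows "compactin (Metric_space.mtopology geodesics geodesics_dist) {v \<in> geodesics. v 0 = p}"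
    (is "compactin ?M ?K")
proof -
  interpret Metric_space "geodesics :: (real \<Rightarrow> 'a) set" geodesics_dist
    by (rule Metric_space_geodesics)
  \<comment> \<open>Compactness is then carried over as that of an image under the identity.\<close>
  have "continuous_map (top_of_set ?K) mtopology id"
    unfolding continuous_map_to_metric
  proof (intro ballI allI impI)
    fix v and \<epsilon> :: real
    assume "v \<in> topspace (top_of_set ?K)" and \<epsilon>: "\<epsilon> > 0"
    then have v: "v \<in> geodesics" "v 0 = p" by auto
    obtain T where T: "T > 0" "\<And>t. t \<ge> T \<Longrightarrow> exp (- t) * (2 * t) < \<epsilon> / 2"
      using exp_neg_times_eventually_small[of "\<epsilon> / 2"] \<epsilon> by auto
    \<comment> \<open>The estimate below adds up to at most 3\<delta>: one \<delta> at the grid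
      point and one for each of the two 1-Lipschitz moves to it.\<close>
    define \<delta> where "\<delta> = \<epsilon> / 8"
    have \<delta>: "\<delta> > 0" using \<epsilon> by (simp add: \<delta>_def)
    \<comment> \<open>A finite grid of mesh \<delta>. Rounding down at the left end keeps the grid
      point just below any t in (-T, T), even if it lies left of -T.\<close>
    define F where "F = (\<lambda>k. real_of_int k * \<delta>) ` {\<lfloor>- T / \<delta>\<rfloor>..\<lfloor>T / \<delta>\<rfloor>}"
    define U where "U = (\<Inter>t\<in>F. {w. dist (v t) (w t) < \<delta>})"
    have "open U"
      unfolding U_def F_def
      by (intro open_INT ballI open_Collect_less continuous_intros
          continuous_on_product_coordinates) auto
    have *: "geodesics_dist v w < \<epsilon>" if w: "w \<in> ?K" "w \<in> U" for w
    proof -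
      have wg: "w \<in> geodesics" "w 0 = p" using w by auto
      have "exp (- \<bar>t\<bar>) * dist (v t) (w t) \<le> \<epsilon> / 2" for t
      proof (cases "\<bar>t\<bar> \<ge> T")
        case True
        have "dist (v t) (w t) \<le> dist (v t) (v 0) + dist (w 0) (w t)"
          using dist_triangle[of "v t" "w t" p] v wg by simp
        also have "\<dots> = 2 * \<bar>t\<bar>"
          by (simp add: geodesicsD v(1) wg(1))
        finally have "exp (- \<bar>t\<bar>) * dist (v t) (w t) \<le> exp (- \<bar>t\<bar>) * (2 * \<bar>t\<bar>)"
          by (rule mult_left_mono) simp
        then show ?thesis using T(2)[OF True] by linarith
      next
        case False
        define k where "k = \<lfloor>t / \<delta>\<rfloor>"
        define u where "u = real_of_int k * \<delta>"
        have "- T / \<delta> \<le> t / \<delta>" "t / \<delta> \<le> T / \<delta>"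
          using False \<delta> by (intro divide_right_mono; linarith)+
        then have "u \<in> F"
          unfolding F_def u_def k_def by (intro imageI) (auto intro!: floor_mono)
        have "real_of_int k \<le> t / \<delta>" "t / \<delta> < real_of_int k + 1"
          unfolding k_def by linarith+
        then have "\<bar>t - u\<bar> \<le> \<delta>"
          using \<delta> by (simp add: u_def field_simps abs_le_iff)
        have "dist (v t) (w t) \<le> dist (v t) (v u) + dist (v u) (w u) + dist (w u) (w t)"
          using dist_triangle[of "v t" "w t" "v u"] dist_triangle[of "v u" "w t" "w u"] by linarith
        also have "\<dots> = \<bar>t - u\<bar> + dist (v u) (w u) + \<bar>u - t\<bar>"
          by (simp add: geodesicsD v(1) wg(1))
        also have "\<dots> \<le> \<bar>t - u\<bar> + \<delta> + \<bar>u - t\<bar>"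
          using \<open>u \<in> F\<close> w(2) by (simp add: U_def less_imp_le)
        also have "\<dots> \<le> \<epsilon> / 2"
          using \<open>\<bar>t - u\<bar> \<le> \<delta>\<close> \<epsilon> by (simp add: \<delta>_def abs_minus_commute)
        finally have "dist (v t) (w t) \<le> \<epsilon> / 2" .
        moreover have "exp (- \<bar>t\<bar>) * dist (v t) (w t) \<le> dist (v t) (w t)"
          by (simp add: mult_left_le_one_le)
        ultimately show ?thesis by linarith
      qed
      \<comment> \<open>The supremum preserves only weak inequalities, hence the aim
        \<epsilon>/2.\<close>
      then have "geodesics_dist v w \<le> \<epsilon> / 2"
        using geodesics_dist_least v wg by blast
      then show ?thesis using \<epsilon> by simp
    qed
    show "\<exists>U. openin (top_of_set ?K) U \<and> v \<in> U \<and> (\<forall>y\<in>U. id y \<in> mball (id v) \<epsilon>)"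
    proof (intro exI[of _ "?K \<inter> U"] conjI ballI)
      show "openin (top_of_set ?K) (?K \<inter> U)"
        using \<open>open U\<close> by (rule openin_open_Int)
      show "v \<in> ?K \<inter> U"
        using v \<delta> by (auto simp: U_def)
    qed (use * v in auto)
  qed
  moreover have "compactin (top_of_set ?K) ?K"
    using compact_geodesics_from_pointwise[OF assms] by (simp add: compactin_subtopology)
  ultimately show ?thesis
    using image_compactin by fastforce
qed

section \<open>Geodesics through two given points\<close>

text \<open>Completeness extends a segment from \<open>x\<close> to \<open>y\<close> to a geodesic,
  and flowing by \<open>a\<close> moves its start to time 0.\<close>

lemma geodesic_through:
  fixes x y :: "'a::metric_space"
  assumes "geodesic_metric_space TYPE('a)" and "geodesically_complete TYPE('a)"
  obtains v where "v \<in> geodesics" "v 0 = x" "v (dist x y) = y"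
proof -
  obtain a b c where c: "geodesic_segment a b c" "c a = x" "c b = y"
  \<comment> \<open>\<open>geodesic_metric_space\<close> concerns distinct points only; for equal
    points the one-point segment on [0, 0] is extended.\<close>
  proof (cases "x = y")
    case True
    then show ?thesis
      by (intro that[of 0 0 "\<lambda>_. x"])
         (auto simp: geodesic_segment_def isometric_embedding_on_def)
  next
    case False
    then show ?thesis
      using assms(1) that unfolding geodesic_metric_space_def by blast
  qed
  then obtain v where v: "geodesic v" "\<And>t. t \<in> {a..b} \<Longrightarrow> v t = c t"
    using assms(2) unfolding geodesically_complete_def by blast
  have "a \<le> b" using c by (simp add: geodesic_segment_def)
  have vg: "v \<in> geodesics" using v by (simp add: geodesics_def)
  have ends: "v a = x" "v b = y" using v \<open>a \<le> b\<close> c by auto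
  then have "dist x y = b - a"
    using geodesicsD[OF vg, of a b] \<open>a \<le> b\<close> by simp
  then show thesis
    using that[OF geodesic_flow_in_geodesics[OF vg, of a]] ends by (simp add: geodesic_flow_def)
qed

section \<open>Spanning numbers and their exponential growth\<close>

lemma geodesic_flow_funpow: "(geodesic_flow 1 ^^ i) v = geodesic_flow (real i) v"
  by (induction i) (auto simp: geodesic_flow_def add.assoc algebra_simps)

lemma span_number_pos:
  assumes "Y \<noteq> {}"
  shows "span_number d f Y n \<epsilon> \<ge> 1"
  unfolding span_number_def
proof (rule INF_greatest)
  fix A assume "A \<in> {A. spans d f Y n \<epsilon> A}"
  then have "A \<noteq> {}" using assms by (auto simp: spans_def)
  then show "1 \<le> ext_card A"
    by (auto simp: ext_card_def one_enat_def card_gt_0_iff Suc_le_eq)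
qed

lemma span_number_attained:
  assumes "span_number d f Y n \<epsilon> = enat m"
  obtains A where "spans d f Y n \<epsilon> A" "finite A" "card A = m"
proof -
  \<comment> \<open>An empty infimum would be \<infinity>; a nonempty one is attained because
    \<open>enat\<close> is well-ordered.\<close>
  have "{A. spans d f Y n \<epsilon> A} \<noteq> {}"
  proof
    assume "{A. spans d f Y n \<epsilon> A} = {}"
    then have "span_number d f Y n \<epsilon> = \<infinity>"
      unfolding span_number_def by (simp only: image_empty Inf_empty top_enat_def)
    then show False using assms by simp
  qed
  then have "span_number d f Y n \<epsilon> \<in> ext_card ` {A. spans d f Y n \<epsilon> A}"
    unfolding span_number_def by (metis ex_in_conv image_is_empty wellorder_InfI)
  then obtain A where "spans d f Y n \<epsilon> A" "ext_card A = enat m"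
    using assms by auto
  then show thesis
    using that by (auto simp: ext_card_def split: if_splits)
qed

text \<open>This puts every exponent above the growth rate into the range s \<ge> 0 over which
  \<open>critical_exponent\<close> takes its infimum.\<close>

lemma span_growth_nonneg:
  assumes "Y \<noteq> {}"
  shows "span_growth d f Y \<epsilon> \<ge> 0"
  unfolding span_growth_def
proof (rule le_Limsup)
  have "0 \<le> log_enat (span_number d f Y n \<epsilon>)" for n
    using log_enat_mono[OF span_number_pos[OF assms]] by (simp add: one_enat_def zero_ereal_def)
  then show "\<forall>\<^sub>F n in sequentially. 0 \<le> ereal (1 / real n) * log_enat (span_number d f Y n \<epsilon>)"
    by (simp add: ereal_zero_le_0_iff)
qed simp

lemma span_growth_le_top_entropy:
  assumes "compactin (Metric_space.mtopology Z d) K" and "\<epsilon> > 0"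
  shows "span_growth d f K \<epsilon> \<le> top_entropy Z d f"
proof -
  have "span_growth d f K \<epsilon> \<le> top_entropy_on d f K"
    unfolding top_entropy_on_eq_SUP using assms(2) by (intro SUP_upper) auto
  also have "\<dots> \<le> top_entropy Z d f"
    unfolding top_entropy_def using assms(1) by (intro SUP_upper) auto
  finally show ?thesis .
qed

lemma span_number_eventually_le:
  assumes "span_growth d f Y \<epsilon> < ereal s"
  shows "\<forall>\<^sub>F n in sequentially. \<exists>m. span_number d f Y n \<epsilon> = enat m \<and> real m \<le> exp (s * real n)"
proof -
  have "\<forall>\<^sub>F n in sequentially. ereal (1 / real n) * log_enat (span_number d f Y n \<epsilon>) < ereal s"
    using assms unfolding span_growth_def by (rule Limsup_lessD)
  then show ?thesis
    \<comment> \<open>At n = 0 the factor \<open>1 / real n\<close> is 0, and an infinite spanning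
      number could not be excluded.\<close>
    using eventually_gt_at_top[of 0]
  proof eventually_elim
    case (elim n)
    show ?case
    proof (cases "span_number d f Y n \<epsilon>")
      case (enat m)
      have "real m \<le> exp (s * real n)"
      proof (cases "m = 0")
        case False
        then have "ln (real m) / real n < s"
          using elim enat by simp
        then have "ln (real m) < s * real n"
          using elim by (simp add: field_simps)
        then have "exp (ln (real m)) < exp (s * real n)"
          by (simp only: exp_less_cancel_iff)
        then show ?thesis
          using False by simp
      qed simp
      then show ?thesis using enat by simp
    next
      case infinity
      then show ?thesis using elim by simp
    qed
  qed
qed

section \<open>Counting orbit points\<close>

lemma finite_orbit_points_in_ball:
  fixes act :: "'g \<Rightarrow> 'a::metric_space \<Rightarrow> 'a"
  assumes "proper_metric_space TYPE('a)" and "properly_discontinuous_action G act"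
  shows "finite {g \<in> carrier G. dist x (act g q) \<le> r}"
proof -
  \<comment> \<open>The radius is enlarged so that the ball contains \<open>q\<close>; then
    \<open>act g q\<close> lies both in the ball and in its translate.\<close>
  let ?B = "cball x (max r (dist x q))"
  have "finite {g \<in> carrier G. act g ` ?B \<inter> ?B \<noteq> {}}"
    using assms unfolding proper_metric_space_def properly_discontinuous_action_def by blast
  moreover have "{g \<in> carrier G. dist x (act g q) \<le> r} \<subseteq> {g \<in> carrier G. act g ` ?B \<inter> ?B \<noteq> {}}"
  proof clarify
    fix g assume "dist x (act g q) \<le> r" "act g ` ?B \<inter> ?B = {}"
    moreover have "act g q \<in> act g ` ?B" by simp
    ultimately show False by (metis disjoint_iff max.coboundedI1 mem_cball)
  qed
  ultimately show ?thesis by (rule rev_finite_subset)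
qed

text \<open>For a fixed \<open>h\<close> in the left-hand set, sending g to h^-1 g injects that set
  into the right-hand one, since d(q, h^-1 g q) = d(h q, g q). The bound is thus uniform in the
  centre \<open>x\<close>.\<close>

lemma card_orbit_points_in_ball_le:
  fixes act :: "'g \<Rightarrow> 'a::metric_space \<Rightarrow> 'a"
  assumes proper: "proper_metric_space TYPE('a)"
    and action: "group_action G (UNIV :: 'a set) act"
    and isom: "isometric_action G act"
    and pd: "properly_discontinuous_action G act"
  shows "card {g \<in> carrier G. dist x (act g q) \<le> r} \<le> card {g \<in> carrier G. dist q (act g q) \<le> 2 * r}"
    (is "card ?S \<le> card ?N")
proof (cases "?S = {}")
  case False
  interpret group_action G UNIV act by (rule action)
  interpret group G using group_hom by (simp add: group_hom_def)
  from False obtain h where h: "h \<in> carrier G" "dist x (act h q) \<le> r" by auto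
  show ?thesis
  proof (rule card_inj_on_le)
    show "inj_on (\<lambda>g. inv\<^bsub>G\<^esub> h \<otimes>\<^bsub>G\<^esub> g) ?S"
      using h by (auto simp: inj_on_def)
    show "finite ?N"
      by (rule finite_orbit_points_in_ball[OF proper pd])
    show "(\<lambda>g. inv\<^bsub>G\<^esub> h \<otimes>\<^bsub>G\<^esub> g) ` ?S \<subseteq> ?N"
    proof clarify
      fix g assume g: "g \<in> carrier G" "dist x (act g q) \<le> r"
      have "dist q (act (inv\<^bsub>G\<^esub> h \<otimes>\<^bsub>G\<^esub> g) q)
          = dist (act (inv\<^bsub>G\<^esub> h) (act h q)) (act (inv\<^bsub>G\<^esub> h) (act g q))"
        using g h by (simp add: composition_rule orbit_sym_aux)
      also have "\<dots> = dist (act h q) (act g q)"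
        using isom h by (simp add: isometric_action_def isometric_embedding_on_def)
      also have "\<dots> \<le> 2 * r"
        using dist_triangle3[of "act h q" "act g q" x] g h by simp
      finally show "inv\<^bsub>G\<^esub> h \<otimes>\<^bsub>G\<^esub> g \<in> carrier G \<and> dist q (act (inv\<^bsub>G\<^esub> h \<otimes>\<^bsub>G\<^esub> g) q) \<le> 2 * r"
        using g h by simp
    qed
  qed
next
  case True
  then show ?thesis by (simp only: card.empty)
qed

text \<open>The length \<open>Suc n\<close> makes n one of the times \<open>i < Suc n\<close>. The
  radius 2 is 1 for shadowing plus 1 for the width of a shell, and 4 is its double from
  \<open>card_orbit_points_in_ball_le\<close>.\<close>

lemma card_orbit_shell_le_spanning_set:
  fixes act :: "'g \<Rightarrow> 'a::metric_space \<Rightarrow> 'a"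
  assumes proper: "proper_metric_space TYPE('a)"
    and geod: "geodesic_metric_space TYPE('a)" "geodesically_complete TYPE('a)"
    and action: "group_action G (UNIV :: 'a set) act"
    and isom: "isometric_action G act"
    and pd: "properly_discontinuous_action G act"
    and A: "spans geodesics_dist (geodesic_flow 1) {v \<in> geodesics. v 0 = p} (Suc n) 1 A" "finite A"
  shows "card {g \<in> carrier G. nat \<lfloor>dist p (act g q)\<rfloor> = n}
    \<le> card A * card {g \<in> carrier G. dist q (act g q) \<le> 4}"
    (is "card ?S \<le> _ * card ?N")
proof -
  let ?B = "\<lambda>a. {g \<in> carrier G. dist (a (real n)) (act g q) \<le> 2}"
  have "?S \<subseteq> (\<Union>a\<in>A. ?B a)"
  proof (rule subsetI)
    fix g assume "g \<in> ?S"
    then have g: "g \<in> carrier G" and n: "n = nat \<lfloor>dist p (act g q)\<rfloor>" by auto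
    let ?d = "dist p (act g q)"
    have d: "real n \<le> ?d" "?d < real n + 1"
      unfolding n by (simp_all add: of_nat_nat)
    obtain v where v: "v \<in> geodesics" "v 0 = p" "v ?d = act g q"
      using geodesic_through[OF geod] by blast
    then obtain a where a: "a \<in> A"
        "geodesics_dist ((geodesic_flow 1 ^^ n) v) ((geodesic_flow 1 ^^ n) a) \<le> 1"
      using A(1) unfolding spans_def by blast
    then have ag: "a \<in> geodesics" using A(1) by (auto simp: spans_def)
    \<comment> \<open>The weight exp(-|t|) is 1 at t = 0, so the distance of the geodesics flowed by
      n bounds that of their points at time n.\<close>
    have "dist (v (real n)) (a (real n)) \<le> 1"
      using geodesics_dist_upper[of "geodesic_flow (real n) v" "geodesic_flow (real n) a" 0]
        a(2) v ag by (simp add: geodesic_flow_in_geodesics geodesic_flow_funpow)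
        (simp add: geodesic_flow_def)
    moreover have "dist (v (real n)) (act g q) \<le> 1"
      using geodesicsD[OF v(1), of "real n" ?d] v d by simp
    ultimately have "dist (a (real n)) (act g q) \<le> 2"
      using dist_triangle3[of "a (real n)" "act g q" "v (real n)"] by simp
    then show "g \<in> (\<Union>a\<in>A. ?B a)" using a g by blast
  qed
  then have "card ?S \<le> card (\<Union>a\<in>A. ?B a)"
    using A(2) finite_orbit_points_in_ball[OF proper pd] by (intro card_mono) auto
  also have "\<dots> \<le> (\<Sum>a\<in>A. card (?B a))"
    by (rule card_UN_le[OF A(2)])
  also have "\<dots> \<le> (\<Sum>a\<in>A. card ?N)"
    using card_orbit_points_in_ball_le[OF proper action isom pd, of _ q 2]
    by (intro sum_mono) simp
  finally show ?thesis by simp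
qed

section \<open>Convergence of the Poincare series\<close>

text \<open>On the n-th shell f \<ge> n, so each term is at most exp(-s n). Grouping any finite
  partial sum by shells bounds it by the sum of the given series.\<close>

lemma summable_on_exp_neg_of_shells:
  fixes f :: "'b \<Rightarrow> real"
  assumes nonneg: "\<And>x. x \<in> S \<Longrightarrow> f x \<ge> 0"
    and fin: "\<And>n. finite {x \<in> S. nat \<lfloor>f x\<rfloor> = n}"
    and "s \<ge> 0"
    and summ: "summable (\<lambda>n. real (card {x \<in> S. nat \<lfloor>f x\<rfloor> = n}) * exp (- s * real n))"
  shows "(\<lambda>x. exp (- s * f x)) summable_on S"
proof (rule nonneg_bdd_above_summable_on)
  let ?c = "\<lambda>n. real (card {x \<in> S. nat \<lfloor>f x\<rfloor> = n}) * exp (- s * real n)"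
  show "bdd_above (sum (\<lambda>x. exp (- s * f x)) ` {F. F \<subseteq> S \<and> finite F})"
  proof (rule bdd_aboveI2)
    fix F assume "F \<in> {F. F \<subseteq> S \<and> finite F}"
    then have F: "F \<subseteq> S" "finite F" by auto
    let ?I = "(\<lambda>x. nat \<lfloor>f x\<rfloor>) ` F"
    have "(\<Sum>x\<in>F. exp (- s * f x)) = (\<Sum>n\<in>?I. \<Sum>x\<in>{x. x \<in> F \<and> nat \<lfloor>f x\<rfloor> = n}. exp (- s * f x))"
      using F by (intro sum.group[symmetric]) auto
    also have "\<dots> \<le> (\<Sum>n\<in>?I. ?c n)"
    proof (rule sum_mono)
      fix n
      let ?F = "{x. x \<in> F \<and> nat \<lfloor>f x\<rfloor> = n}"
      have "(\<Sum>x\<in>?F. exp (- s * f x)) \<le> (\<Sum>x\<in>?F. exp (- s * real n))"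
      proof (rule sum_mono)
        fix x assume "x \<in> ?F"
        then have "real n \<le> f x"
          using nonneg F by (auto simp: of_nat_nat)
        then show "exp (- s * f x) \<le> exp (- s * real n)"
          using \<open>s \<ge> 0\<close> by (simp add: mult_left_mono)
      qed
      also have "\<dots> \<le> ?c n"
        using card_mono[OF fin, of ?F n] F by auto
      finally show "(\<Sum>x\<in>?F. exp (- s * f x)) \<le> ?c n" .
    qed
    also have "\<dots> \<le> suminf ?c"
      using F by (intro sum_le_suminf summ) auto
    finally show "(\<Sum>x\<in>F. exp (- s * f x)) \<le> suminf ?c" .
  qed
qed simp

theorem lemma5:
  fixes \<Gamma> :: "('g, 'm) monoid_scheme"
    and act :: "'g \<Rightarrow> 'a::metric_space \<Rightarrow> 'a"
    and p q :: 'a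
  assumes "proper_metric_space TYPE('a)"
    and "geodesic_metric_space TYPE('a)"
    and "geodesically_complete TYPE('a)"
    and "group_action \<Gamma> (UNIV :: 'a set) act"
    and "isometric_action \<Gamma> act"
    and "properly_discontinuous_action \<Gamma> act"
  shows "flow_entropy (geodesics :: (real \<Rightarrow> 'a) set) geodesics_dist geodesic_flow
           \<ge> critical_exponent \<Gamma> act p q"
proof (rule ccontr)
  define K where "K = {v \<in> geodesics. v 0 = p}"
  let ?h = "span_growth geodesics_dist (geodesic_flow 1) K 1"
  let ?S = "\<lambda>n. {g \<in> carrier \<Gamma>. nat \<lfloor>dist p (act g q)\<rfloor> = n}"
  define N where "N = card {g \<in> carrier \<Gamma>. dist q (act g q) \<le> 4}"
  assume "\<not> ?thesis"
  \<comment> \<open>The single scale 1 is enough for a lower bound, as the entropy is a supremum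
    over compact sets and scales.\<close>
  moreover have "?h \<le> flow_entropy (geodesics :: (real \<Rightarrow> 'a) set) geodesics_dist geodesic_flow"
    unfolding flow_entropy_def K_def
    by (intro span_growth_le_top_entropy compactin_geodesics_from assms) simp
  ultimately have "?h < critical_exponent \<Gamma> act p q" by simp
  then obtain s where s: "?h < ereal s" "ereal s < critical_exponent \<Gamma> act p q"
    using ereal_dense2 by blast
  \<comment> \<open>The gap between s' and s yields the ratio exp(s' - s) < 1 of the dominating
    geometric series.\<close>
  obtain s' where s': "?h < ereal s'" "ereal s' < ereal s"
    using ereal_dense2[OF s(1)] by blast
  have "K \<noteq> {}"
    using geodesic_through[OF assms(2,3), of p p] by (auto simp: K_def)
  then have "s \<ge> 0"
    using s(1) span_growth_nonneg[of K] by (metis ereal_less_eq(5) le_less_trans less_imp_le)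
  have fin: "finite (?S n)" for n
  proof (rule finite_subset)
    show "?S n \<subseteq> {g \<in> carrier \<Gamma>. dist p (act g q) \<le> real n + 1}"
      by auto
  qed (rule finite_orbit_points_in_ball[OF assms(1,6)])
  \<comment> \<open>The shift to \<open>Suc n\<close> matches the shell estimate and costs only the
    constant factor exp s' below.\<close>
  have "\<forall>\<^sub>F n in sequentially. \<exists>m. span_number geodesics_dist (geodesic_flow 1) K (Suc n) 1 = enat m
      \<and> real m \<le> exp (s' * real (Suc n))"
    using span_number_eventually_le[OF s'(1)]
    by (rule eventually_compose_filterlim[OF _ filterlim_Suc])
  then have "\<forall>\<^sub>F n in sequentially. norm (real (card (?S n)) * exp (- s * real n))
      \<le> real N * exp s' * exp (s' - s) ^ n"
  proof eventually_elim
    case (elim n)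
    then obtain m where m: "span_number geodesics_dist (geodesic_flow 1) K (Suc n) 1 = enat m"
        "real m \<le> exp (s' * real (Suc n))" by blast
    obtain A where A: "spans geodesics_dist (geodesic_flow 1) K (Suc n) 1 A" "finite A" "card A = m"
      using span_number_attained[OF m(1)] .
    then have "card (?S n) \<le> m * N"
      using card_orbit_shell_le_spanning_set[OF assms A(1)[unfolded K_def] A(2), of q] by (simp add: N_def)
    then have "real (card (?S n)) \<le> real m * real N"
      by (metis of_nat_le_iff of_nat_mult)
    also have "\<dots> \<le> exp (s' * real (Suc n)) * real N"
      using m(2) by (intro mult_right_mono) auto
    finally have "real (card (?S n)) * exp (- s * real n)
        \<le> exp (s' * real (Suc n)) * real N * exp (- s * real n)"
      by (intro mult_right_mono) auto
    also have "\<dots> = real N * exp s' * exp (s' - s) ^ n"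
      by (simp add: exp_of_nat_mult[symmetric] exp_add[symmetric] algebra_simps)
    finally show ?case by simp
  qed
  moreover have "summable (\<lambda>n. real N * exp s' * exp (s' - s) ^ n)"
    using s'(2) by (intro summable_mult summable_geometric) simp
  ultimately have "summable (\<lambda>n. real (card (?S n)) * exp (- s * real n))"
    by (rule summable_comparison_test_ev)
  then have "(\<lambda>g. exp (- s * dist p (act g q))) summable_on carrier \<Gamma>"
    using fin \<open>s \<ge> 0\<close> by (intro summable_on_exp_neg_of_shells) auto
  then have "critical_exponent \<Gamma> act p q \<le> ereal s"
    unfolding critical_exponent_def using \<open>s \<ge> 0\<close> by (intro Inf_lower) auto
  then show False using s(2) by simp
qed

end
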